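(* Let $D$ and $k$ be positive integers, and let $G=(V,E)$ be a finite graph on $n\ge 1$ nodes whose maximum degree is at most $D$. Then \[ \mathrm{sep}_k(G)\le \mathrm{sep}_k^*(G)\Bigl(2+\ln\frac{D}{2\,\mathrm{sep}_k^*(G)}\Bigr). \]
   Context: For $A\subseteq V$, $\partial A$ denotes the set of edges of $G$ connecting $A$ to $V\setminus A$. A set $T\subseteq E$ of edges is $k$-splitting if every connected component of $G\setminus T$ (the graph $(V,E\setminus T)$) has at most $k$ nodes; $\mathrm{sep}_k(G)$ is the minimum of $|T|/n$ over all $k$-splitting edge sets $T$. Let $\mathcal{R}_k=\mathcal{R}_k(G)$ be the family of sets $A\subseteq V$ with $1\le |A|\le k$ that induce a connected subgraph of $G$. A fractional $\mathcal{R}_k$-partition is a weighting $x:\mathcal{R}_k\to\mathbb{R}$ with $x_A\ge 0$ for all $A$ and $\sum_{A\in\mathcal{R}_k,\,A\ni v}x_A=1$ for every $v\in V$. Define $\mathrm{sep}_k^*(G)=\min_x \frac{1}{2n}\sum_{A\in\mathcal{R}_k}x_A|\partial A|$, where $x$ ranges over all fractional $\mathcal{R}_k$-partitions. *)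

theory Defs
  imports "HOL-Analysis.Analysis"
begin

definition simple_graph :: "'a set \<Rightarrow> 'a set set \<Rightarrow> bool" where
  "simple_graph V E \<longleftrightarrow> finite V \<and> (\<forall>e\<in>E. e \<subseteq> V \<and> card e = 2)"

definition vertex_degree :: "'a set set \<Rightarrow> 'a \<Rightarrow> nat" where
  "vertex_degree E v = card {e \<in> E. v \<in> e}"

definition max_degree :: "'a set \<Rightarrow> 'a set set \<Rightarrow> nat" where
  "max_degree V E = Max (vertex_degree E ` V)"

definition adj_rel :: "'a set set \<Rightarrow> 'a rel" where
  "adj_rel E = {(u, v). {u, v} \<in> E}"

definition graph_components :: "'a set \<Rightarrow> 'a set set \<Rightarrow> 'a set set" where
  "graph_components V E = V // {(u, v) \<in> V \<times> V. (u, v) \<in> (adj_rel E)\<^sup>*}"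

definition connected_graph :: "'a set \<Rightarrow> 'a set set \<Rightarrow> bool" where
  "connected_graph V E \<longleftrightarrow> V \<noteq> {} \<and> (\<forall>u\<in>V. \<forall>v\<in>V. (u, v) \<in> (adj_rel E)\<^sup>*)"

definition induced_edges :: "'a set set \<Rightarrow> 'a set \<Rightarrow> 'a set set" where
  "induced_edges E A = {e \<in> E. e \<subseteq> A}"

definition edge_boundary :: "'a set \<Rightarrow> 'a set set \<Rightarrow> 'a set \<Rightarrow> 'a set set" where
  "edge_boundary V E A = {e \<in> E. \<exists>u\<in>A. \<exists>v\<in>V - A. e = {u, v}}"

definition k_splitting :: "'a set \<Rightarrow> 'a set set \<Rightarrow> nat \<Rightarrow> 'a set set \<Rightarrow> bool" where
  "k_splitting V E k T \<longleftrightarrow> T \<subseteq> E \<and> (\<forall>C\<in>graph_components V (E - T). card C \<le> k)"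

definition sep :: "'a set \<Rightarrow> 'a set set \<Rightarrow> nat \<Rightarrow> real" where
  "sep V E k = Min {real (card T) / real (card V) | T. k_splitting V E k T}"

definition small_connected_sets :: "'a set \<Rightarrow> 'a set set \<Rightarrow> nat \<Rightarrow> 'a set set" where
  "small_connected_sets V E k =
     {A. A \<subseteq> V \<and> 1 \<le> card A \<and> card A \<le> k \<and> connected_graph A (induced_edges E A)}"

text \<open>Weightings are total functions on sets; only their values on
  \<open>small_connected_sets V E k\<close> are constrained or used.\<close>

definition fractional_partition ::
    "'a set \<Rightarrow> 'a set set \<Rightarrow> nat \<Rightarrow> ('a set \<Rightarrow> real) \<Rightarrow> bool" where
  "fractional_partition V E k x \<longleftrightarrow>
     (\<forall>A\<in>small_connected_sets V E k. x A \<ge> 0) \<and>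
     (\<forall>v\<in>V. (\<Sum>A | A \<in> small_connected_sets V E k \<and> v \<in> A. x A) = 1)"

definition fractional_cost ::
    "'a set \<Rightarrow> 'a set set \<Rightarrow> nat \<Rightarrow> ('a set \<Rightarrow> real) \<Rightarrow> real" where
  "fractional_cost V E k x =
     1 / (2 * real (card V)) *
       (\<Sum>A\<in>small_connected_sets V E k. x A * real (card (edge_boundary V E A)))"

text \<open>The infimum is a minimum; see \<open>sep_star_attained\<close> below. It may be \<open>0\<close>;
  then \<open>s * (2 + ln (D / (2 * s)))\<close> with \<open>s = 0\<close> evaluates to \<open>0\<close>, which is also its limit
  as \<open>s\<close> tends to \<open>0\<close> from above.\<close>

definition sep_star :: "'a set \<Rightarrow> 'a set set \<Rightarrow> nat \<Rightarrow> real" where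
  "sep_star V E k = Inf {fractional_cost V E k x | x. fractional_partition V E k x}"

lemma finite_small_connected_sets:
  "finite V \<Longrightarrow> finite (small_connected_sets V E k)"
  unfolding small_connected_sets_def
  by (rule finite_subset[of _ "Pow V"]) auto

lemma fractional_partition_exists:
  fixes V :: "'a set"
  assumes "finite V" "k > 0"
  shows "\<exists>x. fractional_partition V E k x"
proof -
  define x :: "'a set \<Rightarrow> real" where "x A = (if card A = 1 then 1 else 0)" for A
  have "(\<Sum>A | A \<in> small_connected_sets V E k \<and> v \<in> A. x A) = 1" if v: "v \<in> V" for v
  proof -
    have s: "{v} \<in> small_connected_sets V E k"
      using v assms by (auto simp: small_connected_sets_def connected_graph_def)
    have "(\<Sum>A | A \<in> small_connected_sets V E k \<and> v \<in> A. x A) = (\<Sum>A\<in>{{v}}. x A)"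
      using s finite_small_connected_sets[OF assms(1)]
      by (intro sum.mono_neutral_right) (auto simp: x_def card_Suc_eq)
    then show ?thesis by (simp add: x_def)
  qed
  then have "fractional_partition V E k x"
    by (auto simp: fractional_partition_def x_def)
  then show ?thesis by blast
qed

lemma sep_star_attained:
  fixes V :: "'a set"
  assumes V: "finite V" and k: "k > 0"
  shows "\<exists>x. fractional_partition V E k x \<and> fractional_cost V E k x = sep_star V E k \<and>
           (\<forall>y. fractional_partition V E k y \<longrightarrow> fractional_cost V E k x \<le> fractional_cost V E k y)"
proof -
  define R where "R = small_connected_sets V E k"
  have fR: "finite R" unfolding R_def by (rule finite_small_connected_sets[OF V])
  define B where "B = (\<Pi>\<^sub>E A\<in>UNIV. if A \<in> R then {0..1::real} else {0})"
  define P where "P = {x. \<forall>v\<in>V. (\<Sum>A | A \<in> R \<and> v \<in> A. x A) = (1::real)}"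
  have coord: "continuous_on UNIV (\<lambda>x :: 'a set \<Rightarrow> real. x A)" for A
    by (rule continuous_on_product_coordinates)
  have "compactin (product_topology (\<lambda>_. euclidean) UNIV) B"
    unfolding B_def by (subst compactin_PiE) auto
  then have cB: "compact B"
    by (simp add: euclidean_product_topology)
  have "closed (\<Inter>v\<in>V. {x :: 'a set \<Rightarrow> real. (\<Sum>A | A \<in> R \<and> v \<in> A. x A) = 1})"
    by (intro closed_INT ballI closed_Collect_eq continuous_on_sum coord continuous_on_const)
  then have "closed P" by (simp add: P_def Collect_ball_eq)
  then have comp: "compact (B \<inter> P)" using cB by (rule compact_Int_closed[rotated])
  have FP: "fractional_partition V E k x" if "x \<in> B \<inter> P" for x
    using that unfolding B_def P_def fractional_partition_def R_def[symmetric]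
    by (auto simp: PiE_iff split: if_splits)
  have restr: "\<exists>x\<in>B \<inter> P. fractional_cost V E k x = fractional_cost V E k y"
    if y: "fractional_partition V E k y" for y
  proof -
    define x where "x A = (if A \<in> R then y A else 0)" for A
    have nn: "y A \<ge> 0" if "A \<in> R" for A
      using y that by (auto simp: fractional_partition_def R_def)
    have s1: "(\<Sum>A | A \<in> R \<and> v \<in> A. y A) = 1" if "v \<in> V" for v
      using y that by (auto simp: fractional_partition_def R_def)
    have "y A \<le> 1" if A: "A \<in> R" for A
    proof -
      obtain v where v: "v \<in> A" "v \<in> V"
        using A unfolding R_def small_connected_sets_def connected_graph_def by auto
      have "y A \<le> (\<Sum>A | A \<in> R \<and> v \<in> A. y A)"
        using v A fR nn by (intro member_le_sum) auto
      then show ?thesis using s1[OF v(2)] by simp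
    qed
    then have "x \<in> B" using nn by (auto simp: B_def PiE_iff x_def)
    moreover have "x \<in> P" using s1 by (simp add: P_def x_def)
    moreover have "fractional_cost V E k x = fractional_cost V E k y"
      by (simp add: fractional_cost_def x_def R_def[symmetric])
    ultimately show ?thesis by blast
  qed
  have "continuous_on (B \<inter> P) (fractional_cost V E k)"
    unfolding fractional_cost_def
    by (intro continuous_intros continuous_on_subset[OF coord]) auto
  moreover have "B \<inter> P \<noteq> {}"
    using restr fractional_partition_exists[OF V k] by blast
  ultimately obtain x where x: "x \<in> B \<inter> P"
      "\<forall>z\<in>B \<inter> P. fractional_cost V E k x \<le> fractional_cost V E k z"
    using continuous_attains_inf[OF comp] by blast
  have least: "fractional_cost V E k x \<le> fractional_cost V E k y"
    if "fractional_partition V E k y" for y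
    using restr[OF that] x(2) by metis
  have "sep_star V E k = fractional_cost V E k x"
    unfolding sep_star_def using FP[OF x(1)] least by (intro cInf_eq_minimum) auto
  then show ?thesis using FP[OF x(1)] least by metis
qed

end

(* An optimal fractional partition x can be rounded at the loss of a factor of only 2, which
   suffices because the logarithm is nonnegative: sep_k^* is at most D/2. The rounding removes sets
   A one after the other, turning the nodes of A not removed before into a class. Let y_e be the
   total weight of the sets splitting the edge e. Drawing A with probability proportional to x_A,
   the edges split among the remaining nodes have total weight sum y_e, while the edges met by A
   carry in expectation at least that much y-weight, as each edge is met with total weight at
   least 1. Hence some A splits at most as many edges as the y-weight it removes, and in the end
   at most sum y_e = 2 n sep_k^* edges are split. *)
theory Submission imports Defs
begin

section \<open>Rounding a fractional partition to a colouring of the nodes\<close>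

definition splits :: "'a set \<Rightarrow> 'a set \<Rightarrow> bool" where
  "splits A e \<longleftrightarrow> e \<inter> A \<noteq> {} \<and> \<not> e \<subseteq> A"

text \<open>Taken over the whole family \<open>R\<close>, whichever nodes are still left, so that an
  edge keeps one fixed budget throughout the rounding.\<close>

definition split_weight :: "'a set set \<Rightarrow> ('a set \<Rightarrow> real) \<Rightarrow> 'a set \<Rightarrow> real" where
  "split_weight R x e = (\<Sum>A | A \<in> R \<and> splits A e. x A)"

text \<open>The colour of a node will be the set of \<open>R\<close> that removes it, so bichromatic
  edges are those running between two classes.\<close>

definition bichromatic :: "('a \<Rightarrow> 'b) \<Rightarrow> 'a set \<Rightarrow> bool" where
  "bichromatic f e \<longleftrightarrow> (\<exists>u\<in>e. \<exists>v\<in>e. f u \<noteq> f v)"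

lemma split_weight_nonneg:
  assumes "\<And>A. A \<in> R \<Longrightarrow> x A \<ge> 0"
  shows "split_weight R x e \<ge> 0"
  unfolding split_weight_def using assms by (intro sum_nonneg) auto

lemma sum_split_weight:
  assumes "finite R" "finite F"
  shows "(\<Sum>e\<in>F. split_weight R x e) = (\<Sum>A\<in>R. x A * real (card {e \<in> F. splits A e}))"
proof -
  have "(\<Sum>e\<in>F. split_weight R x e) = (\<Sum>A\<in>R. \<Sum>e | e \<in> F \<and> splits A e. x A)"
    unfolding split_weight_def using assms(2,1) by (rule sum.swap_restrict)
  then show ?thesis by (simp add: mult.commute)
qed

text \<open>An averaging argument by contradiction, with the unnormalised weights \<open>x\<close>.
  The condition \<open>A \<inter> U \<noteq> {}\<close> is what makes the set of remaining nodes
  shrink. Covering is assumed for nodes of \<open>U\<close> only, so the same \<open>R\<close> and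
  \<open>x\<close> serve every smaller \<open>U\<close>.\<close>

lemma exists_cheap_set:
  fixes x :: "'a set \<Rightarrow> real"
  assumes R: "finite R" and F: "finite F"
    and nn: "\<And>A. A \<in> R \<Longrightarrow> x A \<ge> 0"
    and one: "\<And>v. v \<in> U \<Longrightarrow> (\<Sum>A | A \<in> R \<and> v \<in> A. x A) = 1"
    and edges: "\<And>e. e \<in> F \<Longrightarrow> e \<subseteq> U \<and> e \<noteq> {}"
    and u: "u \<in> U"
  shows "\<exists>A\<in>R. A \<inter> U \<noteq> {} \<and>
    real (card {e \<in> F. splits A e}) \<le> (\<Sum>e | e \<in> F \<and> e \<inter> A \<noteq> {}. split_weight R x e)"
proof (rule ccontr)
  define y where "y = split_weight R x"
  define c where "c A = real (card {e \<in> F. splits A e})" for A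
  define d where "d A = (\<Sum>e | e \<in> F \<and> e \<inter> A \<noteq> {}. y e)" for A
  assume "\<not> ?thesis"
  then have less: "d A < c A" if "A \<in> R" "A \<inter> U \<noteq> {}" for A
    using that by (force simp: y_def c_def d_def)
  \<comment> \<open>Sets missing \<open>U\<close> meet no edge of \<open>F\<close>, so their
    \<open>d A\<close> is 0 and the weak inequality extends to all of \<open>R\<close>.\<close>
  have le: "d A \<le> c A" if "A \<in> R" for A
  proof (cases "A \<inter> U = {}")
    case True
    then have "{e \<in> F. e \<inter> A \<noteq> {}} = {}" using edges by blast
    then have "d A = 0" unfolding d_def by (simp only: sum.empty)
    then show ?thesis by (simp add: c_def)
  qed (use less that in force)
  have y0: "y e \<ge> 0" for e unfolding y_def by (rule split_weight_nonneg[OF nn])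
  \<comment> \<open>Strictness in the weighted sum needs a set of positive weight that meets
    \<open>U\<close>; one of those covering \<open>u\<close> will do.\<close>
  obtain B where B: "B \<in> R" "u \<in> B" "x B > 0"
  proof -
    have "(\<Sum>A | A \<in> R \<and> u \<in> A. x A) > 0" using one[OF u] by simp
    then obtain B where "B \<in> {A. A \<in> R \<and> u \<in> A}" "x B > 0"
      by (meson not_le sum_nonpos)
    then show ?thesis using that by blast
  qed
  have "(\<Sum>A\<in>R. x A * d A) < (\<Sum>A\<in>R. x A * c A)"
  proof (rule sum_strict_mono_ex1[OF R])
    show "\<forall>A\<in>R. x A * d A \<le> x A * c A" using le nn by (simp add: mult_left_mono)
    show "\<exists>A\<in>R. x A * d A < x A * c A" using B u less[of B] by (intro bexI[of _ B]) auto
  qed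
  also have "\<dots> = (\<Sum>e\<in>F. y e)"
    unfolding y_def c_def by (rule sum_split_weight[OF R F, symmetric])
  also have "\<dots> \<le> (\<Sum>e\<in>F. \<Sum>A | A \<in> R \<and> e \<inter> A \<noteq> {}. x A * y e)"
  proof (rule sum_mono)
    fix e assume "e \<in> F"
    \<comment> \<open>A single node of \<open>e\<close> already receives weight 1 from the sets
      containing it, and all of these meet \<open>e\<close>.\<close>
    then obtain v where v: "v \<in> e" "v \<in> U" using edges by blast
    have "1 = (\<Sum>A | A \<in> R \<and> v \<in> A. x A)" using one v by simp
    also have "\<dots> \<le> (\<Sum>A | A \<in> R \<and> e \<inter> A \<noteq> {}. x A)"
      using v R nn by (intro sum_mono2) auto
    finally have "1 * y e \<le> (\<Sum>A | A \<in> R \<and> e \<inter> A \<noteq> {}. x A) * y e"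
      using y0 by (rule mult_right_mono)
    then show "y e \<le> (\<Sum>A | A \<in> R \<and> e \<inter> A \<noteq> {}. x A * y e)"
      by (simp add: sum_distrib_right)
  qed
  also have "\<dots> = (\<Sum>A\<in>R. x A * d A)"
    unfolding d_def sum_distrib_left using F R by (rule sum.swap_restrict)
  finally show False by simp
qed

text \<open>Induction on the remaining nodes: a cheap \<open>A\<close> colours
  \<open>U \<inter> A\<close>, and the induction hypothesis colours \<open>U - A\<close>. Edges
  inside \<open>U\<close> that meet \<open>A\<close> pay for the edges split by \<open>A\<close>,
  edges inside \<open>U - A\<close> pay for the rest, and no edge pays twice.\<close>

lemma exists_cheap_colouring:
  fixes x :: "'a set \<Rightarrow> real"
  assumes R: "finite R" and E: "finite E" and "finite U"
    and nn: "\<And>A. A \<in> R \<Longrightarrow> x A \<ge> 0"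
    and one: "\<And>v. v \<in> U \<Longrightarrow> (\<Sum>A | A \<in> R \<and> v \<in> A. x A) = 1"
    and ne: "{} \<notin> E"
  shows "\<exists>f. (\<forall>v\<in>U. v \<in> f v \<and> f v \<in> R) \<and>
    real (card {e \<in> E. e \<subseteq> U \<and> bichromatic f e}) \<le> (\<Sum>e | e \<in> E \<and> e \<subseteq> U. split_weight R x e)"
  using \<open>finite U\<close> one
proof (induction U rule: finite_psubset_induct)
  case (psubset U)
  let ?y = "split_weight R x"
  show ?case
  proof (cases "U = {}")
    case True
    then have empty: "{e \<in> E. e \<subseteq> U \<and> P e} = {}" "{e \<in> E. e \<subseteq> U} = {}" for P
      using ne by auto
    show ?thesis unfolding empty using True by simp
  next
    case False
    then obtain u where u: "u \<in> U" by blast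
    let ?F = "{e \<in> E. e \<subseteq> U}"
    have F: "finite ?F" using E by simp
    have "e \<subseteq> U \<and> e \<noteq> {}" if "e \<in> ?F" for e using that ne by auto
    from exists_cheap_set[OF R F nn psubset.prems this u]
    obtain A where A: "A \<in> R" "A \<inter> U \<noteq> {}"
      and cheap: "real (card {e \<in> ?F. splits A e}) \<le> (\<Sum>e | e \<in> ?F \<and> e \<inter> A \<noteq> {}. ?y e)"
      by blast
    have sub: "U - A \<subset> U" using A by blast
    obtain g where g: "\<forall>v\<in>U - A. v \<in> g v \<and> g v \<in> R"
      "real (card {e \<in> E. e \<subseteq> U - A \<and> bichromatic g e}) \<le> (\<Sum>e | e \<in> E \<and> e \<subseteq> U - A. ?y e)"
      using psubset.IH[OF sub] psubset.prems by auto
    define f where "f v = (if v \<in> A then A else g v)" for v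
    \<comment> \<open>An edge inside \<open>A\<close> is monochromatic, and an edge disjoint from
      \<open>A\<close> keeps its colours under \<open>g\<close>; all others are split by
      \<open>A\<close>.\<close>
    have "{e \<in> ?F. bichromatic f e}
        \<subseteq> {e \<in> ?F. splits A e} \<union> {e \<in> E. e \<subseteq> U - A \<and> bichromatic g e}"
    proof
      fix e assume e: "e \<in> {e \<in> ?F. bichromatic f e}"
      then obtain a b where ab: "a \<in> e" "b \<in> e" "f a \<noteq> f b"
        unfolding bichromatic_def by blast
      consider "splits A e" | "e \<subseteq> A" | "e \<inter> A = {}" unfolding splits_def by blast
      then show "e \<in> {e \<in> ?F. splits A e} \<union> {e \<in> E. e \<subseteq> U - A \<and> bichromatic g e}"
      proof cases
        case 2
        then have "f a = f b" using ab(1,2) unfolding f_def by (simp add: subsetD)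
        then show ?thesis using ab(3) by blast
      next
        case 3
        then have "a \<notin> A" "b \<notin> A" using ab by blast+
        then have "bichromatic g e" using ab unfolding bichromatic_def f_def by auto
        moreover have "e \<subseteq> U - A" using 3 e by blast
        ultimately show ?thesis using e by blast
      qed (use e in blast)
    qed
    then have "card {e \<in> ?F. bichromatic f e}
        \<le> card ({e \<in> ?F. splits A e} \<union> {e \<in> E. e \<subseteq> U - A \<and> bichromatic g e})"
      using E by (intro card_mono) auto
    also have "\<dots> \<le> card {e \<in> ?F. splits A e} + card {e \<in> E. e \<subseteq> U - A \<and> bichromatic g e}"
      by (rule card_Un_le)
    finally have "real (card {e \<in> ?F. bichromatic f e})
        \<le> (\<Sum>e | e \<in> ?F \<and> e \<inter> A \<noteq> {}. ?y e) + (\<Sum>e | e \<in> E \<and> e \<subseteq> U - A. ?y e)"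
      using cheap g(2) by linarith
    also have "\<dots> = (\<Sum>e\<in>{e. e \<in> ?F \<and> e \<inter> A \<noteq> {}} \<union> {e. e \<in> E \<and> e \<subseteq> U - A}. ?y e)"
      using E by (intro sum.union_disjoint[symmetric]) auto
    also have "{e. e \<in> ?F \<and> e \<inter> A \<noteq> {}} \<union> {e. e \<in> E \<and> e \<subseteq> U - A} = ?F"
      by blast
    finally have "real (card {e \<in> E. e \<subseteq> U \<and> bichromatic f e}) \<le> (\<Sum>e\<in>?F. ?y e)"
      by (simp add: conj_assoc)
    moreover have "\<forall>v\<in>U. v \<in> f v \<and> f v \<in> R"
      using A(1) g(1) by (simp add: f_def)
    ultimately show ?thesis by blast
  qed
qed

section \<open>From colourings to splitting edge sets\<close>

lemma simple_graph_finite_edges: "simple_graph V E \<Longrightarrow> finite E"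
  unfolding simple_graph_def by (rule finite_subset[of _ "Pow V"]) auto

text \<open>An edge has exactly two endpoints, both in \<open>V\<close>, so meeting \<open>A\<close>
  without lying in it means one endpoint in \<open>A\<close> and the other in
  \<open>V - A\<close>.\<close>

lemma edge_boundary_eq_splits:
  assumes "simple_graph V E" "A \<subseteq> V"
  shows "edge_boundary V E A = {e \<in> E. splits A e}"
proof (rule set_eqI)
  fix e
  have "(\<exists>u\<in>A. \<exists>v\<in>V - A. e = {u, v}) \<longleftrightarrow> splits A e" if e: "e \<in> E"
  proof -
    obtain a b where ab: "e = {a, b}" "a \<in> V" "b \<in> V"
      using e assms(1) unfolding simple_graph_def by (metis card_2_iff insert_subset)
    then show ?thesis unfolding splits_def by (auto simp: doubleton_eq_iff)
  qed
  then show "e \<in> edge_boundary V E A \<longleftrightarrow> e \<in> {e \<in> E. splits A e}"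
    unfolding edge_boundary_def by blast
qed

text \<open>Edges that survive are monochromatic, so \<open>f\<close> is constant along paths. Each
  node lies in its own colour, hence the component of \<open>u\<close> is contained in the set
  \<open>f u\<close>, which has at most \<open>k\<close> nodes.\<close>

lemma k_splitting_bichromatic:
  assumes "finite V"
    and f: "\<And>v. v \<in> V \<Longrightarrow> v \<in> f v \<and> f v \<subseteq> V \<and> card (f v) \<le> k"
  shows "k_splitting V E k {e \<in> E. bichromatic f e}"
proof -
  let ?G = "E - {e \<in> E. bichromatic f e}"
  have const: "f u = f v" if "(u, v) \<in> (adj_rel ?G)\<^sup>*" for u v
    using that
  proof (induction rule: rtrancl_induct)
    case (step a b)
    then show ?case unfolding adj_rel_def bichromatic_def by auto
  qed simp
  have "card C \<le> k" if C: "C \<in> graph_components V ?G" for C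
  proof -
    obtain u where u: "u \<in> V"
      "C = {(u, v) \<in> V \<times> V. (u, v) \<in> (adj_rel ?G)\<^sup>*} `` {u}"
      using C unfolding graph_components_def quotient_def by blast
    have "C \<subseteq> f u"
    proof
      fix v assume "v \<in> C"
      then have "v \<in> V" "(u, v) \<in> (adj_rel ?G)\<^sup>*" using u(2) by auto
      then show "v \<in> f u" using f[of v] const[of u v] by simp
    qed
    then show ?thesis
      using f[OF u(1)] \<open>finite V\<close> by (meson card_mono finite_subset order_trans)
  qed
  then show ?thesis unfolding k_splitting_def by auto
qed

lemma sep_le_card:
  assumes "finite E" "k_splitting V E k T"
  shows "sep V E k \<le> real (card T) / real (card V)"
proof -
  \<comment> \<open>\<open>Min\<close> bounds its members from below only on a finite set; this
    holds here as splitting sets are subsets of \<open>E\<close>.\<close>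
  have "finite ((\<lambda>T. real (card T) / real (card V)) ` Pow E)" using assms(1) by simp
  then have "finite {real (card T) / real (card V) | T. k_splitting V E k T}"
    by (rule finite_subset[rotated]) (auto simp: k_splitting_def)
  then show ?thesis unfolding sep_def using assms(2) by (intro Min_le) auto
qed

text \<open>The colouring cuts at most as many edges as the sum of \<open>x A\<close> times the
  boundary size of \<open>A\<close>. The cost divides this sum by twice \<open>card V\<close>, since
  an honest partition counts each cut edge from both sides; hence the factor 2.\<close>

lemma sep_le_twice_fractional_cost:
  assumes G: "simple_graph V E" and x: "fractional_partition V E k x"
  shows "sep V E k \<le> 2 * fractional_cost V E k x"
proof -
  define R where "R = small_connected_sets V E k"
  have V: "finite V" and E: "finite E" and ne: "{} \<notin> E" and sub: "\<And>e. e \<in> E \<Longrightarrow> e \<subseteq> V"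
    using G simple_graph_finite_edges[OF G] by (auto simp: simple_graph_def)
  have R: "finite R" unfolding R_def by (rule finite_small_connected_sets[OF V])
  have RV: "A \<subseteq> V \<and> card A \<le> k" if "A \<in> R" for A
    using that by (auto simp: R_def small_connected_sets_def)
  have nn: "x A \<ge> 0" if "A \<in> R" for A
    using x that by (auto simp: fractional_partition_def R_def)
  have one: "(\<Sum>A | A \<in> R \<and> v \<in> A. x A) = 1" if "v \<in> V" for v
    using x that by (auto simp: fractional_partition_def R_def)
  have EV: "{e \<in> E. e \<subseteq> V} = E" "{e \<in> E. e \<subseteq> V \<and> P e} = {e \<in> E. P e}" for P
    using sub by auto
  obtain f where f: "\<forall>v\<in>V. v \<in> f v \<and> f v \<in> R"
    and c: "real (card {e \<in> E. bichromatic f e}) \<le> (\<Sum>e\<in>E. split_weight R x e)"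
    using exists_cheap_colouring[OF R E V nn one ne] unfolding EV by blast
  have "sep V E k \<le> real (card {e \<in> E. bichromatic f e}) / real (card V)"
    using f RV by (intro sep_le_card[OF E] k_splitting_bichromatic[OF V]) auto
  also have "\<dots> \<le> (\<Sum>e\<in>E. split_weight R x e) / real (card V)"
    using c by (rule divide_right_mono) simp
  also have "(\<Sum>e\<in>E. split_weight R x e) = (\<Sum>A\<in>R. x A * real (card (edge_boundary V E A)))"
    unfolding sum_split_weight[OF R E]
    using edge_boundary_eq_splits[OF G] RV by (intro sum.cong) auto
  finally show ?thesis
    unfolding fractional_cost_def R_def[symmetric] by simp
qed

section \<open>Bounds on the fractional cost\<close>

lemma card_edge_boundary_le:
  assumes G: "simple_graph V E" and A: "A \<subseteq> V"
  shows "card (edge_boundary V E A) \<le> max_degree V E * card A"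
proof -
  have V: "finite V" and E: "finite E"
    using G simple_graph_finite_edges[OF G] by (auto simp: simple_graph_def)
  have fA: "finite A" using A V by (rule finite_subset)
  have "edge_boundary V E A \<subseteq> (\<Union>v\<in>A. {e \<in> E. v \<in> e})"
    unfolding edge_boundary_def by auto
  then have "card (edge_boundary V E A) \<le> card (\<Union>v\<in>A. {e \<in> E. v \<in> e})"
    using fA E by (intro card_mono) auto
  also have "\<dots> \<le> (\<Sum>v\<in>A. vertex_degree E v)"
    unfolding vertex_degree_def by (rule card_UN_le[OF fA])
  also have "\<dots> \<le> (\<Sum>v\<in>A. max_degree V E)"
    unfolding max_degree_def using A V by (intro sum_mono Max_ge) auto
  finally show ?thesis by (simp add: mult.commute)
qed

text \<open>For the upper bound, a boundary has at most \<open>D * card A\<close> edges, and double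
  counting of pairs of a node and a set containing it shows that the sizes \<open>card A\<close>,
  weighted by \<open>x A\<close>, add up to \<open>card V\<close>.\<close>

lemma fractional_cost_bounds:
  assumes G: "simple_graph V E" and x: "fractional_partition V E k x" and D: "max_degree V E \<le> D"
  shows "0 \<le> fractional_cost V E k x" "fractional_cost V E k x \<le> real D / 2"
proof -
  define R where "R = small_connected_sets V E k"
  have V: "finite V" using G by (simp add: simple_graph_def)
  have R: "finite R" unfolding R_def by (rule finite_small_connected_sets[OF V])
  have RV: "A \<subseteq> V" if "A \<in> R" for A
    using that by (auto simp: R_def small_connected_sets_def)
  have nn: "x A \<ge> 0" if "A \<in> R" for A
    using x that by (auto simp: fractional_partition_def R_def)
  show "0 \<le> fractional_cost V E k x"
    unfolding fractional_cost_def R_def[symmetric] using nn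
    by (intro mult_nonneg_nonneg sum_nonneg) auto
  have "(\<Sum>A\<in>R. x A * real (card A)) = (\<Sum>A\<in>R. \<Sum>v | v \<in> V \<and> v \<in> A. x A)"
  proof (rule sum.cong[OF refl])
    fix A assume "A \<in> R"
    then have "{v. v \<in> V \<and> v \<in> A} = A" using RV by blast
    then show "x A * real (card A) = (\<Sum>v | v \<in> V \<and> v \<in> A. x A)" by simp
  qed
  also have "\<dots> = (\<Sum>v\<in>V. \<Sum>A | A \<in> R \<and> v \<in> A. x A)"
    using R V by (rule sum.swap_restrict)
  also have "\<dots> = real (card V)"
    using x by (simp add: fractional_partition_def R_def)
  finally have size: "(\<Sum>A\<in>R. x A * real (card A)) = real (card V)" .
  have "(\<Sum>A\<in>R. x A * real (card (edge_boundary V E A))) \<le> (\<Sum>A\<in>R. x A * (real D * real (card A)))"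
  proof (intro sum_mono mult_left_mono nn)
    fix A assume "A \<in> R"
    then have "card (edge_boundary V E A) \<le> D * card A"
      using card_edge_boundary_le[OF G RV] D by (meson mult_le_mono1 order_trans)
    then show "real (card (edge_boundary V E A)) \<le> real D * real (card A)"
      by (metis of_nat_le_iff of_nat_mult)
  qed
  also have "\<dots> = real D * real (card V)"
    unfolding size[symmetric] by (simp add: sum_distrib_left algebra_simps)
  finally have "fractional_cost V E k x \<le> 1 / (2 * real (card V)) * (real D * real (card V))"
    unfolding fractional_cost_def R_def[symmetric] by (intro mult_left_mono) auto
  then show "fractional_cost V E k x \<le> real D / 2"
    \<comment> \<open>If \<open>card V = 0\<close>, division by zero makes the preceding bound
      0.\<close>
    by (cases "card V = 0") (auto split: if_splits)
qed

theorem theorem5: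
  fixes V :: "'a set" and E :: "'a set set" and D k :: nat
  assumes "simple_graph V E"
    and "card V \<ge> 1"
    and "D > 0"
    and "k > 0"
    and "max_degree V E \<le> D"
  shows "sep V E k \<le> sep_star V E k * (2 + ln (real D / (2 * sep_star V E k)))"
proof -
  have V: "finite V" using assms(1) by (simp add: simple_graph_def)
  define s where "s = sep_star V E k"
  obtain x where x: "fractional_partition V E k x" "fractional_cost V E k x = s"
    using sep_star_attained[OF V assms(4)] unfolding s_def by blast
  have s: "0 \<le> s" "s \<le> real D / 2" "sep V E k \<le> 2 * s"
    using fractional_cost_bounds[OF assms(1) x(1) assms(5)]
      sep_le_twice_fractional_cost[OF assms(1) x(1)] x(2) by auto
  have "s * 2 \<le> s * (2 + ln (real D / (2 * s)))"
  \<comment> \<open>For \<open>s = 0\<close> both sides vanish; otherwise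
    \<open>s \<le> real D / 2\<close> makes the argument of the logarithm at least 1.\<close>
  proof (cases "s = 0")
    case False
    then have "1 \<le> real D / (2 * s)" using s by (simp add: field_simps)
    then show ?thesis using s(1) by (intro mult_left_mono) auto
  qed simp
  then show ?thesis using s(3) unfolding s_def by simp
qed

end
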